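(* Let $G=(V,E,w)$ be a finite weighted directed graph which is connected to its nonempty boundary $\partial V$. Let $F$ be a positive eikonal equation on $G$, i.e. for interior vertices $x\in V\setminus\partial V$, $$F(u)(x)=w_+(x)\,\|\nabla u(x)\|^{+}+f(x,\nabla u(x))-g(x),$$ where $w_+$ and $g$ are strictly positive functions on $V\setminus\partial V$ and $f$ is elliptic and homogeneous. Suppose $u,v:V\to\mathbb{R}$ are solutions, i.e. $F(u)(x)=0$ and $F(v)(x)=0$ for all $x\in V\setminus\partial V$. If $u(x)\le v(x)$ for all $x\in\partial V$, then $u(x)\le v(x)$ for all $x\in V$.
   Context: $G=(V,E,w)$ is a finite weighted directed graph: $V$ is a finite set of vertices, $E\subset V\times V$ is a set of oriented edges $e_{xy}=(x,y)$ from $x$ to $y$, and $w$ assigns a weight $w_{xy}>0$ to each edge $e_{xy}$ joining different vertices. A nonempty subset $\partial V\subset V$ is fixed, called the boundary; vertices of $V\setminus\partial V$ are called interior. A vertex $y\neq x$ is a neighbor of $x$ if there is an edge from $x$ to $y$; $d(x)$ is the number of neighbors of $x$, and it is assumed that $d(x)\ge 1$ for every interior $x$. For each $x$ an ordering $y_1,\dots,y_{d(x)}$ of the neighbors of $x$ is fixed. The graph is connected to the boundary if for every $x\in V$ there is a $y\in\partial V$ and a finite path from $x$ to $y$ proceeding from each vertex to one of its neighbors (i.e. following directed edges). For $u:V\to\mathbb{R}$ and interior $x$, the gradient is $\nabla u(x)=\big(w_{xy_1}(u(y_1)-u(x)),\dots,w_{xy_{d(x)}}(u(y_{d(x)})-u(x))\big)\in\mathbb{R}^{d(x)}$,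 and $\|\nabla u(x)\|^{+}=\max_{1\le i\le d(x)}w_{xy_i}(u(y_i)-u(x))$. For vectors, $\mathbf{p}\le\mathbf{q}$ means $p_i\le q_i$ for all $i$; $\min(\mathbf{p})$ and $\max(\mathbf{p})$ denote the smallest and largest components. A real-valued function $f(x,\mathbf{p})$, defined for interior $x$ and $\mathbf{p}\in\mathbb{R}^{d(x)}$, is elliptic if $\mathbf{p}\le\mathbf{q}$ implies $f(x,\mathbf{p})\le f(x,\mathbf{q})$ for all interior $x$ and $\mathbf{p},\mathbf{q}\in\mathbb{R}^{d(x)}$. An elliptic $f$ is homogeneous if there is a function $w_0:V\setminus\partial V\to[0,\infty)$ with $w_0(x)\min(\mathbf{p})\le f(x,\mathbf{p})\le w_0(x)\max(\mathbf{p})$ for all interior $x$ and all $\mathbf{p}\in\mathbb{R}^{d(x)}$. *)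

theory Defs
  imports Complex_Main "Graph_Theory.Pair_Digraph" "Graph_Theory.Weighted_Graph"
begin

definition neighbors :: "'a pair_pre_digraph \<Rightarrow> 'a \<Rightarrow> 'a set" where
  "neighbors G x = {y. y \<noteq> x \<and> (x, y) \<in> parcs G}"

definition degree_of :: "'a pair_pre_digraph \<Rightarrow> 'a \<Rightarrow> nat" where
  "degree_of G x = card (neighbors G x)"

text \<open>
  A finite weighted directed graph with boundary \<open>B\<close>, together with a fixed ordering
  \<open>nb x\<close> of the neighbors of each vertex \<open>x\<close>. Self-loops are allowed; they carry no
  weight condition and do not count as neighbors.
\<close>

locale weighted_boundary_digraph = pair_fin_digraph G
  for G :: "'a pair_pre_digraph" +
  fixes w :: "('a \<times> 'a) weight_fun"
    and B :: "'a set"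
    and nb :: "'a \<Rightarrow> 'a list"
  assumes weight_pos: "\<And>x y. (x, y) \<in> parcs G \<Longrightarrow> x \<noteq> y \<Longrightarrow> 0 < w (x, y)"
    and boundary_subset: "B \<subseteq> pverts G"
    and boundary_nonempty: "B \<noteq> {}"
    and nb_distinct: "\<And>x. x \<in> pverts G \<Longrightarrow> distinct (nb x)"
    and nb_set: "\<And>x. x \<in> pverts G \<Longrightarrow> set (nb x) = neighbors G x"
    and interior_degree: "\<And>x. x \<in> pverts G - B \<Longrightarrow> 1 \<le> degree_of G x"

definition connected_to_boundary :: "'a pair_pre_digraph \<Rightarrow> 'a set \<Rightarrow> bool" where
  "connected_to_boundary G B \<longleftrightarrow>
     (\<forall>x\<in>pverts G. \<exists>y\<in>B. (x, y) \<in> {(a, b). b \<in> neighbors G a}\<^sup>*)"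

text \<open>
  A vector in \<open>d(x)\<close>-dimensional space is a real list of length \<open>degree_of G x\<close>; its
  \<open>i\<close>-th entry belongs to the \<open>i\<close>-th neighbor of \<open>x\<close> in the list \<open>nb x\<close>.
\<close>

definition gradient ::
    "('a \<times> 'a) weight_fun \<Rightarrow> ('a \<Rightarrow> 'a list) \<Rightarrow> ('a \<Rightarrow> real) \<Rightarrow> 'a \<Rightarrow> real list" where
  "gradient w nb u x = map (\<lambda>y. w (x, y) * (u y - u x)) (nb x)"

definition gradient_norm_plus ::
    "('a \<times> 'a) weight_fun \<Rightarrow> ('a \<Rightarrow> 'a list) \<Rightarrow> ('a \<Rightarrow> real) \<Rightarrow> 'a \<Rightarrow> real" where
  "gradient_norm_plus w nb u x = Max (set (gradient w nb u x))"

definition elliptic ::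
    "'a pair_pre_digraph \<Rightarrow> 'a set \<Rightarrow> ('a \<Rightarrow> real list \<Rightarrow> real) \<Rightarrow> bool" where
  "elliptic G B f \<longleftrightarrow>
     (\<forall>x\<in>pverts G - B. \<forall>p q. length p = degree_of G x \<longrightarrow> length q = degree_of G x \<longrightarrow>
        list_all2 (\<le>) p q \<longrightarrow> f x p \<le> f x q)"

definition homogeneous ::
    "'a pair_pre_digraph \<Rightarrow> 'a set \<Rightarrow> ('a \<Rightarrow> real list \<Rightarrow> real) \<Rightarrow> bool" where
  "homogeneous G B f \<longleftrightarrow>
     (\<exists>w0. \<forall>x\<in>pverts G - B. 0 \<le> w0 x \<and>
        (\<forall>p. length p = degree_of G x \<longrightarrow>
           w0 x * Min (set p) \<le> f x p \<and> f x p \<le> w0 x * Max (set p)))"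

end

theory Submission
  imports Defs
begin

text \<open>
  This is a maximum principle for \<open>u - v\<close>. If \<open>u > v\<close> somewhere, then \<open>u - v\<close> has a positive
  maximum over the finite vertex set, and it is attained only at interior vertices. At a
  maximizer \<open>x\<close> every difference \<open>u y - u x\<close> is at most \<open>v y - v x\<close>, so the gradient of \<open>u\<close> lies
  below that of \<open>v\<close>. Both the positive gradient norm and \<open>f\<close> are monotone in the gradient, and the
  equation forces the same total \<open>g x\<close> for \<open>u\<close> and \<open>v\<close>; since \<open>w_plus x > 0\<close>, the two norms
  must coincide (lemma \<open>gradient_norm_plus_eq\<close>).

  Pure monotonicity would allow a plateau of maximizers, along which nothing contradictory
  happens. Positivity of \<open>g\<close> excludes this: by homogeneity a solution has a positive gradient norm
  (lemma \<open>gradient_norm_plus_pos\<close>), so \<open>u\<close> strictly increases from \<open>x\<close> to a neighbor realizing the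
  norm of its gradient. Equality of the norms makes that neighbor again a maximizer of \<open>u - v\<close>
  (lemma \<open>ascent_within_maximizers\<close>). Hence among the finitely many maximizers
  there is none at which \<open>u\<close> is largest, which is absurd.
\<close>

context weighted_boundary_digraph
begin

lemma neighbor_in_verts:
  assumes "y \<in> neighbors G x"
  shows "y \<in> pverts G"
  using assms arc_snd_in_verts[of "(x, y)"] by (simp add: neighbors_def)

lemma neighbor_weight_pos:
  assumes "y \<in> neighbors G x"
  shows "0 < w (x, y)"
  using assms weight_pos by (auto simp: neighbors_def)

lemma set_gradient:
  assumes "x \<in> pverts G"
  shows "set (gradient w nb h x) = (\<lambda>y. w (x, y) * (h y - h x)) ` neighbors G x"
  using nb_set[OF assms] by (simp add: gradient_def)

lemma length_gradient:
  assumes "x \<in> pverts G"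
  shows "length (gradient w nb h x) = degree_of G x"
  using nb_set[OF assms] nb_distinct[OF assms] distinct_card[of "nb x"]
  by (simp add: gradient_def degree_of_def)

lemma interior_neighbors:
  assumes "x \<in> pverts G - B"
  shows "finite (neighbors G x)" and "neighbors G x \<noteq> {}"
  using interior_degree[OF assms] by (auto simp: degree_of_def card_gt_0_iff Suc_le_eq)

lemma gradient_norm_plus_ge:
  assumes x: "x \<in> pverts G - B" and y: "y \<in> neighbors G x"
  shows "w (x, y) * (h y - h x) \<le> gradient_norm_plus w nb h x"
  using x y interior_neighbors(1)[OF x] by (simp add: gradient_norm_plus_def set_gradient)

lemma gradient_norm_plus_attained:
  assumes x: "x \<in> pverts G - B"
  obtains y where "y \<in> neighbors G x"
    and "gradient_norm_plus w nb h x = w (x, y) * (h y - h x)"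
proof -
  have "gradient_norm_plus w nb h x \<in> (\<lambda>y. w (x, y) * (h y - h x)) ` neighbors G x"
    using x interior_neighbors[OF x] Max_in[of "set (gradient w nb h x)"]
    by (simp add: gradient_norm_plus_def set_gradient)
  then show thesis using that by blast
qed

text \<open>
  If the norm were at most \<open>0\<close>, the homogeneity bound \<open>f \<le> w0 * Max\<close> with \<open>w0 \<ge> 0\<close> would make
  the whole operator at most \<open>0\<close>, leaving no room for a positive \<open>g\<close>.
\<close>

lemma gradient_norm_plus_pos:
  assumes x: "x \<in> pverts G - B"
    and hom: "homogeneous G B f"
    and c: "0 < c"
    and pos: "0 < c * gradient_norm_plus w nb h x + f x (gradient w nb h x)"
  shows "0 < gradient_norm_plus w nb h x"
proof -
  obtain w0 where w0: "0 \<le> w0 x"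
    and le: "f x (gradient w nb h x) \<le> w0 x * gradient_norm_plus w nb h x"
    using hom x length_gradient[of x h]
    unfolding homogeneous_def gradient_norm_plus_def by blast
  from pos le have "0 < (c + w0 x) * gradient_norm_plus w nb h x"
    by (simp add: distrib_right)
  with c w0 show ?thesis by (simp add: zero_less_mult_iff)
qed

text \<open>
  Both summands of the operator are monotone in the gradient, so when the sums agree each
  summand must agree; \<open>c > 0\<close> turns this into equality of the norms.
\<close>

lemma gradient_norm_plus_eq:
  assumes x: "x \<in> pverts G - B"
    and ell: "elliptic G B f"
    and c: "0 < c"
    and below: "\<And>y. y \<in> neighbors G x \<Longrightarrow> u y - u x \<le> v y - v x"
    and eq: "c * gradient_norm_plus w nb u x + f x (gradient w nb u x)
           = c * gradient_norm_plus w nb v x + f x (gradient w nb v x)"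
  shows "gradient_norm_plus w nb u x = gradient_norm_plus w nb v x"
proof -
  have entry: "w (x, y) * (u y - u x) \<le> w (x, y) * (v y - v x)" if "y \<in> neighbors G x" for y
    using below[OF that] neighbor_weight_pos[OF that] by simp
  have "list_all2 (\<le>) (gradient w nb u x) (gradient w nb v x)"
    using x entry by (auto simp: gradient_def list_all2_conv_all_nth nb_set[symmetric])
  then have f_le: "f x (gradient w nb u x) \<le> f x (gradient w nb v x)"
    using ell x length_gradient unfolding elliptic_def by blast
  obtain y where y: "y \<in> neighbors G x"
    and "gradient_norm_plus w nb u x = w (x, y) * (u y - u x)"
    using gradient_norm_plus_attained[OF x] by metis
  then have norm_le: "gradient_norm_plus w nb u x \<le> gradient_norm_plus w nb v x"
    using entry[OF y] gradient_norm_plus_ge[OF x y, of v] by linarith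
  from f_le eq
  have "c * gradient_norm_plus w nb v x \<le> c * gradient_norm_plus w nb u x" by linarith
  with c norm_le show ?thesis by simp
qed

text \<open>
  The ascent step of the argument: a neighbor realizing the norm of the gradient of \<open>u\<close> works. The
  weighted difference of \<open>v\<close> towards it is squeezed between that of \<open>u\<close> and the common norm, so
  \<open>u - v\<close> does not change along this edge.
\<close>

lemma ascent_within_maximizers:
  assumes x: "x \<in> pverts G - B"
    and ell: "elliptic G B f" and hom: "homogeneous G B f"
    and c: "0 < c" and b: "0 < b"
    and u_eq: "c * gradient_norm_plus w nb u x + f x (gradient w nb u x) = b"
    and v_eq: "c * gradient_norm_plus w nb v x + f x (gradient w nb v x) = b"
    and max: "\<And>y. y \<in> pverts G \<Longrightarrow> u y - v y \<le> u x - v x"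
  obtains y where "y \<in> pverts G" and "u y - v y = u x - v x" and "u x < u y"
proof -
  have below: "u y - u x \<le> v y - v x" if "y \<in> neighbors G x" for y
    using max[OF neighbor_in_verts[OF that]] by linarith
  have norm_eq: "gradient_norm_plus w nb u x = gradient_norm_plus w nb v x"
    using gradient_norm_plus_eq[OF x ell c, of u v] below u_eq v_eq by simp
  obtain y where y: "y \<in> neighbors G x"
    and attained: "gradient_norm_plus w nb u x = w (x, y) * (u y - u x)"
    using gradient_norm_plus_attained[OF x] by metis
  have wpos: "0 < w (x, y)" using neighbor_weight_pos[OF y] .
  have "0 < gradient_norm_plus w nb u x"
    using gradient_norm_plus_pos[OF x hom c] u_eq b by simp
  then have up: "u x < u y" using attained wpos by (simp add: zero_less_mult_iff)
  have "w (x, y) * (v y - v x) \<le> w (x, y) * (u y - u x)"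
    using gradient_norm_plus_ge[OF x y, of v] norm_eq attained by simp
  then have "v y - v x \<le> u y - u x" using wpos by simp
  with below[OF y] have "u y - v y = u x - v x" by linarith
  then show thesis using that neighbor_in_verts[OF y] up by blast
qed

end

theorem theorem3:
  fixes G :: "'a pair_pre_digraph"
    and w :: "('a \<times> 'a) weight_fun"
    and B :: "'a set"
    and nb :: "'a \<Rightarrow> 'a list"
    and w_plus g :: "'a \<Rightarrow> real"
    and f :: "'a \<Rightarrow> real list \<Rightarrow> real"
    and F :: "('a \<Rightarrow> real) \<Rightarrow> 'a \<Rightarrow> real"
    and u v :: "'a \<Rightarrow> real"
  assumes graph: "weighted_boundary_digraph G w B nb"
    and conn: "connected_to_boundary G B"
    and w_plus_pos: "\<And>x. x \<in> pverts G - B \<Longrightarrow> 0 < w_plus x"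
    and g_pos: "\<And>x. x \<in> pverts G - B \<Longrightarrow> 0 < g x"
    and f_elliptic: "elliptic G B f"
    and f_homogeneous: "homogeneous G B f"
    and F_eikonal: "\<And>h x. x \<in> pverts G - B \<Longrightarrow>
      F h x = w_plus x * gradient_norm_plus w nb h x + f x (gradient w nb h x) - g x"
    and u_solution: "\<And>x. x \<in> pverts G - B \<Longrightarrow> F u x = 0"
    and v_solution: "\<And>x. x \<in> pverts G - B \<Longrightarrow> F v x = 0"
    and boundary_le: "\<And>x. x \<in> B \<Longrightarrow> u x \<le> v x"
  shows "\<forall>x\<in>pverts G. u x \<le> v x"
proof (rule ccontr)
  interpret weighted_boundary_digraph G w B nb by (fact graph)
  assume "\<not> (\<forall>x\<in>pverts G. u x \<le> v x)"
  then obtain z where z: "z \<in> pverts G" "v z < u z" by force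
  define M where "M = Max ((\<lambda>x. u x - v x) ` pverts G)"
  have M_ge: "u x - v x \<le> M" if "x \<in> pverts G" for x
    using that by (simp add: M_def)
  define A where "A = {x \<in> pverts G. u x - v x = M}"
  have "M \<in> (\<lambda>x. u x - v x) ` pverts G"
    unfolding M_def using z(1) by (intro Max_in) auto
  then have "A \<noteq> {}" by (auto simp: A_def)
  moreover have "finite A" by (simp add: A_def)
  ultimately have "Max (u ` A) \<in> u ` A" by (intro Max_in) auto
  then obtain x where xA: "x \<in> A" and "u x = Max (u ` A)" by auto
  then have top: "u y \<le> u x" if "y \<in> A" for y
    using that \<open>finite A\<close> by simp
  have "0 < M" using M_ge[OF z(1)] z(2) by linarith
  then have x: "x \<in> pverts G - B" using xA boundary_le[of x] by (auto simp: A_def)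
  have u_eq: "w_plus x * gradient_norm_plus w nb u x + f x (gradient w nb u x) = g x"
    using F_eikonal[OF x, of u] u_solution[OF x] by simp
  have v_eq: "w_plus x * gradient_norm_plus w nb v x + f x (gradient w nb v x) = g x"
    using F_eikonal[OF x, of v] v_solution[OF x] by simp
  have max: "u y - v y \<le> u x - v x" if "y \<in> pverts G" for y
    using M_ge[OF that] xA by (simp add: A_def)
  obtain y where "y \<in> pverts G" "u y - v y = u x - v x" "u x < u y"
    using ascent_within_maximizers[OF x f_elliptic f_homogeneous w_plus_pos[OF x] g_pos[OF x]
        u_eq v_eq max] by blast
  with xA top[of y] show False by (simp add: A_def)
qed

end
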